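(* As formal power series in $t$, $$\sum_{n\geq 0}\frac{F_n(1)}{n!}t^n=e^{t-\frac{t^2}{2}}.$$
   Context: Let $S_n$ be the symmetric group on $[n]=\{1,\dots,n\}$ and $\mathscr{I}_n\subseteq S_n$ the set of involutions, i.e. permutations $\sigma$ with $\sigma^2=\mathrm{id}$ (the identity included). For $\sigma\in S_n$, $\mathrm{ris}(\sigma)$ is the number of $i\in\{1,\dots,n-1\}$ with $\sigma(i)<\sigma(i+1)$, and $\mathrm{sgn}(\sigma)$ is the sign of $\sigma$. The signed Eulerian polynomial on involutions is $F_n(t)=\sum_{\sigma\in\mathscr{I}_n}\mathrm{sgn}(\sigma)\,t^{\mathrm{ris}(\sigma)}$, with $F_0(t)=1$; thus $F_n(1)$ is the number of even involutions minus the number of odd involutions in $\mathscr{I}_n$. *)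

theory Defs
  imports
    "HOL-Combinatorics.Permutations"
    "HOL-Computational_Algebra.Polynomial"
    "HOL-Computational_Algebra.Formal_Power_Series"
begin

definition involutions :: "nat \<Rightarrow> (nat \<Rightarrow> nat) set" where
  "involutions n = {\<sigma>. \<sigma> permutes {1..n} \<and> \<sigma> \<circ> \<sigma> = id}"

definition ris :: "nat \<Rightarrow> (nat \<Rightarrow> nat) \<Rightarrow> nat" where
  "ris n \<sigma> = card {i \<in> {1..<n}. \<sigma> i < \<sigma> (i + 1)}"

definition signed_eulerian_inv :: "nat \<Rightarrow> int poly" where
  "signed_eulerian_inv n = (\<Sum>\<sigma>\<in>involutions n. monom (sign \<sigma>) (ris n \<sigma>))"

(* The convention that the polynomial for n = 0 is 1 holds automatically. *)
lemma signed_eulerian_inv_0: "signed_eulerian_inv 0 = 1"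
proof -
  have "involutions 0 = {id}"
    by (auto simp: involutions_def)
  then show ?thesis
    by (simp add: signed_eulerian_inv_def ris_def sign_id)
qed

end

theory Submission
  imports Defs
begin

text \<open>
  Evaluation at \<open>t = 1\<close> forgets the statistic, so \<open>F\<^sub>n(1)\<close> is the signed number of involutions of an
  \<open>n\<close>-element set. Classify the involutions of \<open>S \<union> {a}\<close> by the image of \<open>a\<close>. If \<open>a\<close> is fixed,
  what remains is an involution of \<open>S\<close>; if \<open>a\<close> is exchanged with \<open>b \<in> S\<close>, splitting off the
  transposition leaves an involution of \<open>S - {b}\<close> and flips the sign. Hence
  \<open>F\<^sub>n\<^sub>+\<^sub>2(1) = F\<^sub>n\<^sub>+\<^sub>1(1) - (n + 1) F\<^sub>n(1)\<close> (lemmas \<open>signed_count_insert\<close> and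
  \<open>signed_count_eq_inv_rec\<close>).

  On the other side, \<open>E = exp (t - t\<^sup>2/2)\<close> satisfies \<open>E' = (1 - t) E\<close>, and comparing coefficients of
  \<open>t\<^sup>n\<^sup>+\<^sup>1\<close> shows that the numbers \<open>n! [t\<^sup>n] E\<close> obey the same recurrence with the same two initial
  values (lemma \<open>inv_rec_eq_coeff\<close>).
\<close>

section \<open>Signed enumeration of the involutions of a finite set\<close>

text \<open>
  The recurrence removes arbitrary points, so it leaves the initial segments \<open>{1..n}\<close>;
  all finite ground sets are therefore treated at once.
\<close>

definition involutions_on :: "'b set \<Rightarrow> ('b \<Rightarrow> 'b) set" where
  "involutions_on S = {\<sigma>. \<sigma> permutes S \<and> \<sigma> \<circ> \<sigma> = id}"

definition signed_count :: "'b set \<Rightarrow> int" where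
  "signed_count S = (\<Sum>\<sigma>\<in>involutions_on S. sign \<sigma>)"

lemma finite_involutions_on: "finite S \<Longrightarrow> finite (involutions_on S)"
  unfolding involutions_on_def by (rule finite_subset[OF _ finite_permutations[of S]]) auto

lemma involutions_on_fixing:
  assumes "a \<notin> S"
  shows "{\<sigma> \<in> involutions_on (insert a S). \<sigma> a = a} = involutions_on S"
proof -
  have "\<sigma> permutes insert a S \<and> \<sigma> a = a \<longleftrightarrow> \<sigma> permutes S" for \<sigma>
    using assms permutes_superset[of \<sigma> "insert a S" S] permutes_subset[of \<sigma> S "insert a S"]
    by (auto simp: permutes_not_in)
  then show ?thesis
    by (auto simp: involutions_on_def)
qed

lemma transpose_comp_involution:
  assumes "\<sigma> \<in> involutions_on (insert a S)" "\<sigma> a = b" "a \<notin> S" "b \<in> S"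
  shows "transpose a b \<circ> \<sigma> \<in> involutions_on (S - {b})"
proof -
  have perm: "\<sigma> permutes insert a S" and inv: "\<sigma> (\<sigma> x) = x" for x
    using assms(1) by (auto simp: involutions_on_def fun_eq_iff)
  have b: "\<sigma> b = a" using inv[of a] assms(2) by simp
  have "transpose a b \<circ> \<sigma> permutes insert a S"
    using perm assms(4) by (intro permutes_compose permutes_swap_id) auto
  then have "transpose a b \<circ> \<sigma> permutes (S - {b})"
    by (rule permutes_superset) (use assms b in auto)
  moreover have "(transpose a b \<circ> \<sigma>) \<circ> (transpose a b \<circ> \<sigma>) = id"
  proof
    fix x
    show "((transpose a b \<circ> \<sigma>) \<circ> (transpose a b \<circ> \<sigma>)) x = id x"
    proof (cases "x = a \<or> x = b")
      case True
      then show ?thesis using assms(2) b by auto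
    next
      case False
      then have "\<sigma> x \<noteq> a" "\<sigma> x \<noteq> b" using inv[of x] assms(2) b by auto
      then show ?thesis using False inv by (simp add: transpose_def)
    qed
  qed
  ultimately show ?thesis by (simp add: involutions_on_def)
qed

lemma involution_comp_transpose:
  assumes "\<tau> \<in> involutions_on (S - {b})" "a \<notin> S" "b \<in> S"
  shows "transpose a b \<circ> \<tau> \<in> involutions_on (insert a S)" "(transpose a b \<circ> \<tau>) a = b"
proof -
  have perm: "\<tau> permutes (S - {b})" and inv: "\<tau> (\<tau> x) = x" for x
    using assms(1) by (auto simp: involutions_on_def fun_eq_iff)
  have fix_a: "\<tau> a = a" and fix_b: "\<tau> b = b"
    using perm assms by (auto simp: permutes_not_in)
  have "transpose a b \<circ> \<tau> permutes insert a S"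
    using assms by (intro permutes_compose permutes_swap_id permutes_subset[OF perm]) auto
  moreover have "(transpose a b \<circ> \<tau>) \<circ> (transpose a b \<circ> \<tau>) = id"
  proof
    fix x
    show "((transpose a b \<circ> \<tau>) \<circ> (transpose a b \<circ> \<tau>)) x = id x"
    proof (cases "x = a \<or> x = b")
      case True
      then show ?thesis using fix_a fix_b by auto
    next
      case False
      then have "\<tau> x \<noteq> a" "\<tau> x \<noteq> b" using inv[of x] fix_a fix_b by auto
      then show ?thesis using False inv by (simp add: transpose_def)
    qed
  qed
  ultimately show "transpose a b \<circ> \<tau> \<in> involutions_on (insert a S)"
    by (simp add: involutions_on_def)
  show "(transpose a b \<circ> \<tau>) a = b" using fix_a by simp
qed

text \<open>
  Composition with a fixed transposition is its own inverse, so the two preceding lemmas make it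
  a sign-reversing bijection.
\<close>

lemma sum_sign_moving:
  assumes "finite S" "a \<notin> S" "b \<in> S"
  shows "(\<Sum>\<sigma> | \<sigma> \<in> involutions_on (insert a S) \<and> \<sigma> a = b. sign \<sigma>) = - signed_count (S - {b})"
proof -
  have sgn: "sign (transpose a b \<circ> \<sigma>) = - sign \<sigma>" if "\<sigma> \<in> involutions_on (insert a S)" for \<sigma>
  proof -
    have "\<sigma> permutes insert a S" using that by (simp add: involutions_on_def)
    then have "permutation \<sigma>" using assms(1) by (auto simp: permutation_permutes)
    moreover have "a \<noteq> b" using assms by auto
    ultimately show ?thesis
      by (simp add: sign_compose permutation_swap_id sign_swap_id)
  qed
  have "(\<Sum>\<sigma> | \<sigma> \<in> involutions_on (insert a S) \<and> \<sigma> a = b. sign \<sigma>)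
      = (\<Sum>\<tau>\<in>involutions_on (S - {b}). - sign \<tau>)"
    using assms
    by (intro sum.reindex_bij_witness
          [where i = "\<lambda>\<sigma>. transpose a b \<circ> \<sigma>" and j = "\<lambda>\<sigma>. transpose a b \<circ> \<sigma>"])
      (auto simp: sgn transpose_comp_involution simp flip: comp_assoc
            intro: involution_comp_transpose dest: involution_comp_transpose(2))
  then show ?thesis by (simp add: signed_count_def sum_negf)
qed

lemma signed_count_insert:
  assumes "finite S" "a \<notin> S"
  shows "signed_count (insert a S) = signed_count S - (\<Sum>b\<in>S. signed_count (S - {b}))"
proof -
  let ?I = "involutions_on (insert a S)"
  have "(\<lambda>\<sigma>. \<sigma> a) ` ?I \<subseteq> insert a S"
    by (auto simp: involutions_on_def dest: permutes_in_image[where x = a])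
  then have "signed_count (insert a S) = (\<Sum>b\<in>insert a S. \<Sum>\<sigma> | \<sigma> \<in> ?I \<and> \<sigma> a = b. sign \<sigma>)"
    unfolding signed_count_def using assms
    by (intro sum.group[symmetric] finite_involutions_on) auto
  also have "\<dots> = signed_count S + (\<Sum>b\<in>S. - signed_count (S - {b}))"
    using assms by (simp add: involutions_on_fixing sum_sign_moving signed_count_def)
  finally show ?thesis by (simp add: sum_negf)
qed

fun inv_rec :: "nat \<Rightarrow> int" where
  "inv_rec 0 = 1"
| "inv_rec (Suc 0) = 1"
| "inv_rec (Suc (Suc n)) = inv_rec (Suc n) - int (Suc n) * inv_rec n"

lemma signed_count_eq_inv_rec:
  assumes "finite S"
  shows "signed_count S = inv_rec (card S)"
  using assms
proof (induction "card S" arbitrary: S rule: less_induct)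
  case less
  show ?case
  proof (cases "S = {}")
    case True
    have "involutions_on ({} :: 'a set) = {id}"
      by (auto simp: involutions_on_def)
    then show ?thesis using True by (simp add: signed_count_def sign_id)
  next
    case False
    then obtain a T where S: "S = insert a T" "a \<notin> T"
      by (meson Set.set_insert all_not_in_conv)
    have T: "finite T" using less.prems S by simp
    have card_S: "card S = Suc (card T)" using S T by simp
    have "signed_count T = inv_rec (card T)"
      using less.hyps[of T] card_S T by simp
    moreover have "signed_count (T - {b}) = inv_rec (card T - 1)" if "b \<in> T" for b
      using less.hyps[of "T - {b}"] card_S T that card_Diff1_le[of T b] by simp
    ultimately have "signed_count S = inv_rec (card T) - int (card T) * inv_rec (card T - 1)"
      using S T by (simp add: signed_count_insert)
    then show ?thesis using card_S by (cases "card T") auto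
  qed
qed

lemma poly_signed_eulerian_inv_1: "poly (signed_eulerian_inv n) 1 = inv_rec n"
proof -
  have "poly (signed_eulerian_inv n) 1 = signed_count {1..n}"
    by (simp add: signed_eulerian_inv_def involutions_def signed_count_def involutions_on_def
        poly_sum poly_monom)
  then show ?thesis by (simp add: signed_count_eq_inv_rec)
qed

section \<open>The exponential generating function\<close>

lemma inv_rec_eq_coeff:
  fixes E :: "'a :: field_char_0 fps"
  assumes "fps_deriv E = (1 - fps_X) * E" and E0: "fps_nth E 0 = 1"
  shows "of_int (inv_rec n) / fact n = fps_nth E n"
proof -
  have coeff: "of_nat (Suc k) * fps_nth E (Suc k) = fps_nth ((1 - fps_X) * E) k" for k
    using arg_cong[OF assms(1), of "\<lambda>f. fps_nth f k"] by (simp add: mult.commute)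
  have E1: "fps_nth E (Suc 0) = 1"
    using coeff[of 0] E0 by simp
  have step: "of_nat (Suc (Suc k)) * fps_nth E (Suc (Suc k)) = fps_nth E (Suc k) - fps_nth E k" for k
    using coeff[of "Suc k"] by (simp add: left_diff_distrib)
  show ?thesis
  proof (induction n rule: inv_rec.induct)
    case (3 n)
    have nz: "(of_nat (Suc m) :: 'a) \<noteq> 0" for m
      using of_nat_neq_0 .
    have "of_nat (Suc (Suc n)) * (of_int (inv_rec (Suc (Suc n))) / fact (Suc (Suc n)) :: 'a)
        = of_int (inv_rec (Suc (Suc n))) / fact (Suc n)"
      using nz[of "Suc n"] by (simp only: fact_Suc[of "Suc n"] of_nat_mult) (simp add: divide_simps)
    also have "\<dots> = of_int (inv_rec (Suc n)) / fact (Suc n) - of_int (inv_rec n) / fact n"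
      using nz[of n] by (simp add: diff_divide_distrib del: of_nat_Suc)
    also have "\<dots> = of_nat (Suc (Suc n)) * fps_nth E (Suc (Suc n))"
      using 3 step by simp
    finally show ?case using nz[of "Suc n"] mult_left_cancel by blast
  qed (use E0 E1 in auto)
qed

theorem mainTheorem7:
  shows "Abs_fps (\<lambda>n. of_int (poly (signed_eulerian_inv n) 1) / fact n) =
    fps_compose (fps_exp (1 :: 'a :: field_char_0)) (fps_X - fps_const (1 / 2) * fps_X ^ 2)"
proof -
  define p :: "'a fps" where "p = fps_X - fps_const (1 / 2) * fps_X ^ 2"
  have "fps_deriv p = 1 - fps_const (1 / 2) * (2 * fps_X)"
    unfolding p_def by (simp add: fps_deriv_power numeral_fps_const)
  also have "fps_const (1 / 2) * (2 * fps_X) = (fps_X :: 'a fps)"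
    unfolding numeral_fps_const mult.assoc[symmetric] fps_const_mult by simp
  finally have "fps_deriv p = 1 - fps_X" .
  moreover have "fps_nth p 0 = 0" by (simp add: p_def)
  ultimately have "fps_deriv (fps_exp 1 oo p) = (1 - fps_X) * (fps_exp 1 oo p)"
    by (simp add: fps_compose_deriv mult.commute)
  then show ?thesis
    unfolding p_def[symmetric]
    by (intro fps_ext) (simp add: poly_signed_eulerian_inv_1 inv_rec_eq_coeff)
qed

end
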